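(* Let $c=5/4$, $\alpha>2$, $\lambda_b>0$, $P>0$, $\tilde\sigma^2\ge 0$, $\omega>0$ be constants, let $K\ge 1$ be an integer and $r\in\{1,\dots,2K\}$. Let $D_1,\dots,D_{2K}$ be i.i.d. random variables with density $f_d(x)=2c\lambda_b\pi x e^{-c\lambda_b\pi x^2}$, $x\ge0$, and let $d$ be the $r$-th smallest of them. For $s\in\mathbb{C}$ with $\mathrm{Re}(s)>0$ define $$\varphi(s)=\mathbb{E}\left\{\exp\left(-\frac{\tilde\sigma^2}{P}\,s\,d^{\alpha}-\pi\lambda_b\,\omega\, d^2 s^{2/\alpha}\right)\right\}.$$ Then $$\varphi(s)=c\,r\binom{2K}{r}\sum_{l=0}^{r-1}\frac{(-1)^l\binom{r-1}{l}\,H_{1,1}^{1,1}\left(\frac{\tilde\sigma^2}{P}\,s\left(\pi\lambda_b\left((2K-r+l+1)c+\omega s^{2/\alpha}\right)\right)^{-\alpha/2}\right)}{(2K-r+l+1)c+\omega s^{2/\alpha}},$$ where $H_{1,1}^{1,1}(x)$ denotes $H_{1,1}^{1,1}\left(x\,\middle|\,\begin{smallmatrix}(0,\alpha/2)\\(0,1)\end{smallmatrix}\right)$. Moreover, for fixed $s$, in the limit $\tilde\sigma^2/P\to0$, $$\varphi(s)\to c\,r\binom{2K}{r}\sum_{l=0}^{r-1}\frac{(-1)^l\binom{r-1}{l}}{(2K-r+l+1)c+\omega s^{2/\alpha}}.$$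
   Context: Model: base stations form a homogeneous Poisson point process of intensity $\lambda_b$; user-to-serving-BS distances are modeled as i.i.d. with density $f_d$. Under distance-based NOMA grouping, the $2K$ users of a cell are ranked in increasing order of distance, and $d$ is the distance of the user of rank $r$. $\tilde\sigma^2=\sigma^2\|\mathbf u\|^2$ is filtered noise power, $P$ transmit power per stream, and $\omega>0$ an interference-related constant (in the paper $\Gamma(1-2/\alpha)(\frac{\rho_I}{P}|\mathbf u^{\mathrm H}\mathbf 1|^2)^{2/\alpha}$), held fixed. Principal branches are used for complex powers. Fox H-function: $H_{1,1}^{1,1}\left(x\,\middle|\,\begin{smallmatrix}(0,\alpha/2)\\(0,1)\end{smallmatrix}\right)=\frac{1}{2\pi \mathrm{i}}\int_{\mathcal L}\Gamma(\xi)\Gamma(1-\tfrac{\alpha}{2}\xi)x^{-\xi}d\xi$, with $\mathcal L$ a vertical line $\mathrm{Re}(\xi)=\gamma$, $0<\gamma<2/\alpha$. *)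

theory Defs
  imports "HOL-Probability.Probability"
begin

definition fd :: "real \<Rightarrow> real \<Rightarrow> real \<Rightarrow> real" where
  "fd c lb x = (if 0 \<le> x then 2 * c * lb * pi * x * exp (- c * lb * pi * x^2) else 0)"

definition rth_smallest :: "nat \<Rightarrow> (nat \<Rightarrow> 'a \<Rightarrow> real) \<Rightarrow> nat \<Rightarrow> 'a \<Rightarrow> real" where
  "rth_smallest r D n w = sort (map (\<lambda>i. D i w) [1..<n+1]) ! (r - 1)"

text \<open>Fox H-function H^{1,1}_{1,1}(x | (0,alpha/2); (0,1)) as the Mellin-Barnes integral over the
  vertical line Re xi = gamma, parametrised xi = gamma + i t (so d xi = i dt).
  At x = 0 the integral is not defined; we use the (standard) continuous extension H(0) = 1.\<close>
definition fox_H :: "real \<Rightarrow> real \<Rightarrow> complex \<Rightarrow> complex" where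
  "fox_H alpha gamma x =
     (if x = 0 then 1 else
      complex_of_real (1 / (2 * pi)) *
        integral\<^sup>L lborel (\<lambda>t::real. Gamma (Complex gamma t)
             * Gamma (1 - complex_of_real (alpha / 2) * Complex gamma t)
             * x powr (- Complex gamma t)))"

definition phi :: "'a measure \<Rightarrow> ('a \<Rightarrow> real) \<Rightarrow> real \<Rightarrow> real \<Rightarrow> real \<Rightarrow> real \<Rightarrow> complex \<Rightarrow> complex" where
  "phi M d alpha lb omega q s =
     integral\<^sup>L M (\<lambda>w. exp (- (complex_of_real q * s * complex_of_real (d w powr alpha))
                              - complex_of_real (pi * lb * omega * (d w)^2) * s powr complex_of_real (2 / alpha)))"

end

theory Submission
  imports Defs
begin

text \<open>
  The squared distances are i.i.d. exponential with rate \<open>c \<lambda> \<pi>\<close>, so the square of the \<open>r\<close>-th smallest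
  distance has density \<open>r (n choose r) F^(r-1) (1-F)^(n-r) F'\<close> with \<open>F y = 1 - exp (- c \<lambda> \<pi> y)\<close>. Expanding
  \<open>F^(r-1)\<close> binomially reduces the expectation to integrals of \<open>exp (- A y - B y^(\<alpha>/2))\<close> over \<open>y > 0\<close>
  with \<open>Re A > 0\<close> and \<open>B = q s\<close>. For \<open>q > 0\<close> one inserts the Cahen-Mellin representation
  \<open>exp (- w) = 1/(2 \<pi> i) \<integral> \<Gamma>(\<xi>) w^(-\<xi>) d\<xi>\<close> at \<open>w = B y^(\<alpha>/2)\<close>, exchanges the integrals and
  evaluates the inner one as \<open>\<Gamma>(1 - \<alpha>\<xi>/2) A^(\<alpha>\<xi>/2 - 1)\<close>. The Cahen-Mellin formula is Fourier inversion
  for \<open>u \<mapsto> exp (g u - w exp u)\<close>; it converges absolutely for \<open>Re w > 0\<close> because \<open>\<Gamma>\<close> decays on vertical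
  lines faster than \<open>exp (- p \<bar>t\<bar>)\<close> for every \<open>p < \<pi>/2\<close>.
\<close>

subsection \<open>The Gamma integral with complex rate\<close>

text \<open>Complex \<open>powr\<close> jumps across the negative axis, so continuity cannot be
  invoked. For a real base it splits into explicit measurable cases according to the sign of the
  base.\<close>

lemma borel_measurable_of_real_powr [measurable (raw)]:
  fixes w :: "'a \<Rightarrow> complex"
  assumes [measurable]: "f \<in> borel_measurable M" "w \<in> borel_measurable M"
  shows "(\<lambda>x. complex_of_real (f x) powr w x) \<in> borel_measurable M"
proof -
  have "complex_of_real y powr v = (if y = 0 then 0 else exp (v * (of_real (ln \<bar>y\<bar>) + (if y < 0 then pi else 0) * \<i>)))" for y v
    by (auto simp: powr_def Ln_of_real')
  thus ?thesis by (simp only:) measurable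
qed

text \<open>Euler's integral is taken as a gauge integral together with absolute integrability over
  \<open>lebesgue\<close>; Borel measurability of the integrand moves both to \<open>lborel\<close>.
  The value at rate \<open>a\<close> then reduces to rate 1 by the substitution y -> a y.\<close>

lemma Gamma_integral_real_rate:
  fixes z :: complex and a :: real
  assumes z: "Re z > 0" and a: "a > 0"
  shows "set_integrable lborel {0<..} (\<lambda>y. of_real y powr (z - 1) * exp (- of_real (a * y)))"
    and "(LINT y:{0<..}|lborel. of_real y powr (z - 1) * exp (- of_real (a * y))) = Gamma z * of_real a powr (- z)"
proof -
  let ?f = "\<lambda>a y::real. of_real y powr (z - 1) * exp (- complex_of_real (a * y))"
  have eq: "complex_of_real t powr (z - 1) / of_real (exp (a * t)) = ?f a t" for t a
    by (simp add: exp_minus divide_inverse flip: exp_of_real)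
  have [measurable]: "(\<lambda>y. indicator {0<..} y *\<^sub>R ?f a y) \<in> borel_measurable lborel" for a
    by measurable
  have ac: "?f a absolutely_integrable_on {0<..}" if "a > 0" for a
    using absolutely_integrable_Gamma_integral[OF z that] unfolding eq .
  have int: "set_integrable lborel {0<..} (?f a)" if "a > 0" for a
    using ac[OF that] unfolding set_integrable_def by (subst (asm) integrable_completion) auto
  show "set_integrable lborel {0<..} (?f a)" by (rule int[OF a])
  have one: "(LINT y:{0<..}|lborel. ?f 1 y) = Gamma z"
  proof -
    have "(LINT y:{0<..}|lborel. ?f 1 y) = (LINT y:{0<..}|lebesgue. ?f 1 y)"
      unfolding set_lebesgue_integral_def by (rule integral_completion[symmetric]) auto
    also have "\<dots> = integral {0<..} (?f 1)"
      by (rule set_lebesgue_integral_eq_integral(2)[OF ac]) simp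
    also have "\<dots> = Gamma z"
      using Gamma_integral_complex'[OF z] eq[of _ 1] by (intro integral_unique) simp
    finally show ?thesis .
  qed
  have "Gamma z = (\<integral>y. indicator {0<..} y *\<^sub>R ?f 1 y \<partial>lborel)"
    using one by (simp add: set_lebesgue_integral_def)
  also have "\<dots> = a *\<^sub>R (\<integral>y. indicator {0<..} (0 + a * y) *\<^sub>R ?f 1 (0 + a * y) \<partial>lborel)"
    using a by (subst lborel_integral_real_affine[of a _ 0]) auto
  also have "\<dots> = a *\<^sub>R (\<integral>y. of_real a powr (z - 1) * (indicator {0<..} y *\<^sub>R ?f a y) \<partial>lborel)"
  proof (intro arg_cong[of _ _ "\<lambda>x. a *\<^sub>R x"] Bochner_Integration.integral_cong refl)
    fix y :: real
    show "indicator {0<..} (0 + a * y) *\<^sub>R ?f 1 (0 + a * y) = of_real a powr (z - 1) * (indicator {0<..} y *\<^sub>R ?f a y)"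
      using a by (cases "y > 0") (auto simp: powr_times_real zero_less_mult_iff indicator_def)
  qed
  also have "\<dots> = of_real a * of_real a powr (z - 1) * (LINT y:{0<..}|lborel. ?f a y)"
    by (simp add: set_lebesgue_integral_def scaleR_conv_of_real mult.assoc)
  also have "of_real a * of_real a powr (z - 1) = of_real a powr z"
    using a by (simp add: powr_diff)
  finally show "(LINT y:{0<..}|lborel. ?f a y) = Gamma z * of_real a powr (- z)"
    using a by (simp add: powr_minus field_simps)
qed

lemma Gamma_integral_complex_rate:
  fixes z A :: complex
  assumes z: "Re z > 0" and A: "Re A > 0"
  shows "set_integrable lborel {0<..} (\<lambda>y. of_real y powr (z - 1) * exp (- (A * of_real y)))" (is ?int)
    and "(LINT y:{0<..}|lborel. of_real y powr (z - 1) * exp (- (A * of_real y))) = Gamma z * A powr (- z)" (is ?eq)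
proof -
  \<comment> \<open>For this real \<open>a\<close> we have \<open>\<bar>a - A\<bar> < a\<close>, so expanding \<open>exp ((a - A) y)\<close> and integrating
    termwise turns the claim into the binomial series of \<open>(A / a) powr (- z)\<close>.\<close>
  define a where "a = (cmod A)\<^sup>2 / Re A"
  have A0: "A \<noteq> 0" using A by auto
  have a0: "a > 0" using A A0 by (simp add: a_def)
  define w where "w = of_real a - A"
  have w: "cmod w < a"
  proof -
    have "(cmod w)\<^sup>2 = a\<^sup>2 - 2 * a * Re A + (cmod A)\<^sup>2"
      unfolding w_def cmod_power2 by (simp add: power2_eq_square algebra_simps)
    also have "\<dots> = a\<^sup>2 - (cmod A)\<^sup>2" using A by (simp add: a_def)
    also have "\<dots> < a\<^sup>2" using A0 by simp
    finally show ?thesis using a0 by (simp add: power2_less_imp_less)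
  qed
  \<comment> \<open>The norms of the terms sum to the modulus of the integrand at the real rate
    \<open>b\<close>, which is integrable because \<open>b > 0\<close>. This one function dominates
    all partial sums.\<close>
  define b where "b = a - cmod w"
  have b: "b > 0" using w by (simp add: b_def)
  define t where "t = (\<lambda>n y. indicator {0<..} y *\<^sub>R (w ^ n / fact n * (of_real y powr (z + of_nat n - 1) * exp (- complex_of_real (a * y)))))"
  have tn: "t n y = indicator {0<..} y *\<^sub>R (of_real y powr (z - 1) * exp (- complex_of_real (a * y))
                * ((w * of_real y) ^ n / fact n))" for n y
  proof (cases "y > 0")
    case True
    have "complex_of_real y powr (z + of_nat n - 1) = of_real y powr (z - 1 + of_nat n)"
      by (simp add: algebra_simps)
    also have "\<dots> = of_real y powr (z - 1) * of_real y ^ n"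
      using True by (subst powr_add) (auto simp: powr_nat)
    finally show ?thesis by (simp add: t_def power_mult_distrib)
  qed (simp add: t_def)
  have t_int: "integrable lborel (t n)" for n
  proof -
    have "Re (z + of_nat n) > 0" using z by simp
    from Gamma_integral_real_rate(1)[OF this a0] show ?thesis
      unfolding t_def set_integrable_def by (subst mult_scaleR_right [symmetric])
      (intro integrable_mult_right, simp add: scaleR_conv_of_real mult_ac)
  qed
  have nt: "norm (t n y) = indicator {0<..} y *\<^sub>R (norm (of_real y powr (z - 1) * exp (- complex_of_real (a * y)))
                * ((cmod w * y) ^ n /\<^sub>R fact n))" for n y
    by (cases "y > 0") (auto simp: tn norm_mult norm_power norm_divide power_mult_distrib divide_inverse norm_inverse norm_fact)
  have nsums: "(\<lambda>n. norm (t n y)) sums norm (indicator {0<..} y *\<^sub>R (of_real y powr (z - 1) * exp (- complex_of_real (b * y))))" for y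
  proof -
    have "(\<lambda>n. norm (t n y)) sums (indicator {0<..} y *\<^sub>R (norm (of_real y powr (z - 1) * exp (- complex_of_real (a * y))) * exp (cmod w * y)))"
      unfolding nt by (intro sums_scaleR_right sums_mult exp_converges)
    also have "\<dots> = norm (indicator {0<..} y *\<^sub>R (of_real y powr (z - 1) * exp (- complex_of_real (b * y))))"
      by (auto simp: norm_mult indicator_def b_def algebra_simps simp flip: exp_add)
    finally show ?thesis .
  qed
  have sums: "(\<lambda>n. t n y) sums (indicator {0<..} y *\<^sub>R (of_real y powr (z - 1) * exp (- (A * of_real y))))" for y
  proof -
    have "(\<lambda>n. (w * of_real y) ^ n / fact n) sums exp (w * of_real y)"
      using exp_converges[of "w * of_real y"] by (simp add: scaleR_conv_of_real field_simps)
    hence "(\<lambda>n. t n y) sums (indicator {0<..} y *\<^sub>R (of_real y powr (z - 1) * exp (- complex_of_real (a * y)) * exp (w * of_real y)))"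
      unfolding tn by (intro sums_scaleR_right sums_mult)
    also have "exp (- complex_of_real (a * y)) * exp (w * of_real y) = exp (- (A * of_real y))"
      by (simp add: w_def flip: exp_add) (simp add: algebra_simps)
    hence "of_real y powr (z - 1) * exp (- complex_of_real (a * y)) * exp (w * of_real y) = of_real y powr (z - 1) * exp (- (A * of_real y))"
      by (simp add: mult.assoc)
    finally show ?thesis .
  qed
  have intb: "integrable lborel (\<lambda>y. norm (indicator {0<..} y *\<^sub>R (of_real y powr (z - 1) * exp (- complex_of_real (b * y)))))"
    using Gamma_integral_real_rate(1)[OF z b] unfolding set_integrable_def by (rule integrable_norm)
  have bound: "(\<Sum>n<N. norm (t n y)) \<le> norm (indicator {0<..} y *\<^sub>R (of_real y powr (z - 1) * exp (- complex_of_real (b * y))))" for N y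
    using nsums[of y] by (metis sum_le_suminf sums_iff norm_ge_zero finite_lessThan)
  have dom: "AE y in lborel. norm (\<Sum>n<N. t n y) \<le> norm (indicator {0<..} y *\<^sub>R (of_real y powr (z - 1) * exp (- complex_of_real (b * y))))" for N
    using order.trans[OF norm_sum bound] by auto
  have lim: "AE y in lborel. (\<lambda>N. \<Sum>n<N. t n y) \<longlonglongrightarrow> indicator {0<..} y *\<^sub>R (of_real y powr (z - 1) * exp (- (A * of_real y)))"
    using sums by (auto simp: sums_def)
  have meas: "(\<lambda>y. indicator {0<..} y *\<^sub>R (of_real y powr (z - 1) * exp (- (A * of_real y)))) \<in> borel_measurable lborel"
    by measurable
  have meas': "(\<lambda>y. \<Sum>n<N. t n y) \<in> borel_measurable lborel" for N
    using t_int by (intro borel_measurable_sum) auto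
  show ?int
    unfolding set_integrable_def by (rule integrable_dominated_convergence[OF meas meas' intb lim dom])
  have "(\<lambda>N. integral\<^sup>L lborel (\<lambda>y. \<Sum>n<N. t n y)) \<longlonglongrightarrow> (LINT y:{0<..}|lborel. of_real y powr (z - 1) * exp (- (A * of_real y)))"
    unfolding set_lebesgue_integral_def by (rule integral_dominated_convergence[OF meas meas' intb lim dom])
  also have "(\<lambda>N. integral\<^sup>L lborel (\<lambda>y. \<Sum>n<N. t n y)) = (\<lambda>N. \<Sum>n<N. integral\<^sup>L lborel (t n))"
    using t_int by (subst Bochner_Integration.integral_sum) auto
  finally have "(\<lambda>n. integral\<^sup>L lborel (t n)) sums (LINT y:{0<..}|lborel. of_real y powr (z - 1) * exp (- (A * of_real y)))"
    by (simp add: sums_def)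
  moreover have "(\<lambda>n. integral\<^sup>L lborel (t n)) sums (Gamma z * of_real a powr (- z) * (1 + - w / of_real a) powr (- z))"
  proof -
    have "integral\<^sup>L lborel (t n) = Gamma z * of_real a powr (- z) * (((- z) gchoose n) * (- w / of_real a) ^ n)" for n
    proof -
      have zn: "Re (z + of_nat n) > 0" using z by simp
      have "integral\<^sup>L lborel (t n) = w ^ n / fact n * (Gamma (z + of_nat n) * of_real a powr (- (z + of_nat n)))"
        using Gamma_integral_real_rate(2)[OF zn a0] unfolding t_def set_lebesgue_integral_def
        by (subst mult_scaleR_right [symmetric]) (subst integral_mult_right_zero, simp)
      \<comment> \<open>\<open>pochhammer z n / fact n\<close> is (-1)^n times
        \<open>(- z) gchoose n\<close>; the sign goes into the power of
        \<open>- w / of_real a\<close>.\<close>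
      also have "Gamma (z + of_nat n) = pochhammer z n * Gamma z"
        using z by (subst pochhammer_Gamma) (auto elim!: nonpos_Ints_cases simp: Gamma_eq_zero_iff)
      also have "of_real a powr (- (z + of_nat n)) = of_real a powr (- z) / of_real a ^ n"
        using a0 by (simp add: powr_diff powr_nat)
      finally show ?thesis
        by (simp add: gbinomial_pochhammer power_divide power_minus[of w] field_simps flip: power_mult_distrib)
    qed
    moreover have "norm (- w / of_real a) < 1" using w a0 by (simp add: norm_divide)
    ultimately show ?thesis by (simp only: sums_mult gen_binomial_complex)
  qed
  ultimately have "(LINT y:{0<..}|lborel. of_real y powr (z - 1) * exp (- (A * of_real y))) = Gamma z * of_real a powr (- z) * (1 + - w / of_real a) powr (- z)"
    by (rule sums_unique2)
  also have "1 + - w / of_real a = A / of_real a" using a0 by (simp add: w_def field_simps)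
  \<comment> \<open>\<open>powr\<close> need not be multiplicative in its base, but it is when one
    factor is a positive real, here \<open>a\<close>.\<close>
  also have "A powr (- z) = (of_real a * (A / of_real a)) powr (- z)" using a0 by simp
  hence "Gamma z * of_real a powr (- z) * (A / of_real a) powr (- z) = Gamma z * A powr (- z)"
    using a0 by (subst (asm) powr_times_real_left) auto
  finally show ?eq .
qed

section \<open>Exponential decay of Gamma along vertical lines\<close>

lemma integrable_exp_minus_abs:
  fixes k :: real
  assumes "k > 0"
  shows "integrable lborel (\<lambda>t. exp (- k * \<bar>t\<bar>))"
proof -
  \<comment> \<open>With exponent \<open>1 - 1\<close> the Gamma integrand is exp (- k t) on t > 0;
    adding its reflection covers both half-lines up to the null set {0}.\<close>
  define e where "e = (\<lambda>t. norm (indicator {0<..} t *\<^sub>R (of_real t powr (1 - 1) * exp (- complex_of_real (k * t)))))"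
  have e: "integrable lborel e"
    using Gamma_integral_real_rate(1)[of 1 k] assms unfolding e_def set_integrable_def by (intro integrable_norm) auto
  have "integrable lborel (\<lambda>t. e t + e (0 + (-1) * t))"
    using e by (intro Bochner_Integration.integrable_add lborel_integrable_real_affine) auto
  thus ?thesis
  proof (rule Bochner_Integration.integrable_bound)
    show "AE t in lborel. norm (exp (- k * \<bar>t\<bar>)) \<le> norm (e t + e (0 + (-1) * t))"
      using AE_lborel_singleton[of 0] by eventually_elim (auto simp: e_def indicator_def)
  qed measurable
qed

lemma Gamma_vertical_decay:
  fixes g p :: real
  assumes g: "g > 0" and p: "0 \<le> p" "p < pi / 2"
  obtains C where "\<And>t. cmod (Gamma (Complex g t)) \<le> C * exp (- p * \<bar>t\<bar>)"
proof
  \<comment> \<open>Rotate the ray of integration: the rate \<open>cis q\<close> with \<open>q = \<plusminus>p\<close> contributes the factor \<open>exp (- t q)\<close>.\<close>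
  define I where "I = (LINT y:{0<..}|lborel. norm (of_real y powr (of_real g - 1) * exp (- (complex_of_real (cos p) * of_real y))))"
  fix t :: real
  define q where "q = (if t \<ge> 0 then p else - p)"
  have q: "cos q = cos p" "Arg (cis q) = q" "t * q = p * \<bar>t\<bar>"
    using p by (auto simp: q_def intro!: cis_Arg_unique)
  have c: "cos p > 0" using p by (intro cos_gt_zero_pi) auto
  let ?f = "\<lambda>y. of_real y powr (Complex g t - 1) * exp (- (cis q * complex_of_real y))"
  have "Re (Complex g t) > 0" "Re (cis q) > 0" using g c q by auto
  note G = Gamma_integral_complex_rate[OF this]
  have "Gamma (Complex g t) = (LINT y:{0<..}|lborel. ?f y) * cis q powr (Complex g t)"
    unfolding G(2) by (simp add: powr_minus)
  hence "cmod (Gamma (Complex g t)) = cmod (LINT y:{0<..}|lborel. ?f y) * exp (- p * \<bar>t\<bar>)"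
    using q by (simp add: norm_mult norm_powr_complex)
  also have "cmod (LINT y:{0<..}|lborel. ?f y) \<le> (LINT y:{0<..}|lborel. norm (?f y))"
    using G(1) by (rule set_integral_norm_bound)
  \<comment> \<open>The modulus of the rotated integrand sees only the real part cos q = cos p of
    the rate and the real part \<open>g\<close> of the exponent, so the constant \<open>I\<close>
    does not depend on \<open>t\<close>.\<close>
  also have "\<dots> = I"
    unfolding I_def
  proof (intro set_lebesgue_integral_cong allI impI)
    fix y :: real assume "y \<in> {0<..}"
    thus "norm (?f y) = norm (of_real y powr (of_real g - 1) * exp (- (complex_of_real (cos p) * of_real y)))"
      by (auto simp: norm_mult norm_powr_real_powr q)
  qed auto
  finally show "cmod (Gamma (Complex g t)) \<le> I * exp (- p * \<bar>t\<bar>)" by simp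
qed

lemma continuous_on_Gamma_vertical:
  fixes g :: real
  assumes "g > 0"
  shows "continuous_on UNIV (\<lambda>t. Gamma (Complex g t))"
proof -
  have "isCont (\<lambda>t. Gamma (Complex g t)) t" for t
  proof (rule isCont_Gamma)
    show "isCont (Complex g) t" unfolding Complex_eq by (intro continuous_intros)
    show "Complex g t \<notin> \<int>\<^sub>\<le>\<^sub>0" using assms by (auto elim!: nonpos_Ints_cases simp: complex_eq_iff)
  qed
  thus ?thesis by (simp add: continuous_on_eq_continuous_at)
qed

text \<open>The modulus of z^(-(g + it)) is |z|^(-g) exp (t Arg z), which grows at rate at most |Arg
  z| < pi/2. Gamma decays at any rate below pi/2, so a rate \<open>p\<close> halfway between |Arg z|
  and pi/2 leaves the net decay \<open>k\<close>.\<close>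

lemma integrable_Gamma_powr_vertical:
  fixes g :: real and z :: complex
  assumes g: "g > 0" and z: "Re z > 0"
  shows "integrable lborel (\<lambda>t. Gamma (Complex g t) * z powr (- Complex g t))"
proof -
  have z0: "z \<noteq> 0" using z by auto
  have Arg: "\<bar>Arg z\<bar> < pi / 2" using z Arg_Re_pos by blast
  define p where "p = (\<bar>Arg z\<bar> + pi / 2) / 2"
  have p: "0 \<le> p" "p < pi / 2" "p > \<bar>Arg z\<bar>" using Arg by (auto simp: p_def)
  obtain C where C: "\<And>t. cmod (Gamma (Complex g t)) \<le> C * exp (- p * \<bar>t\<bar>)"
    using Gamma_vertical_decay[OF g p(1,2)] by blast
  define k where "k = p - \<bar>Arg z\<bar>"
  have k: "k > 0" using p by (simp add: k_def)
  have "integrable lborel (\<lambda>t. C * cmod z powr (- g) * exp (- k * \<bar>t\<bar>))"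
    by (intro integrable_mult_right integrable_exp_minus_abs k)
  thus ?thesis
  proof (rule Bochner_Integration.integrable_bound)
    have "continuous_on UNIV (\<lambda>t. Gamma (Complex g t) * exp (- Complex g t * Ln z))"
      unfolding Complex_eq by (intro continuous_intros continuous_on_Gamma_vertical[unfolded Complex_eq] g)
    thus "(\<lambda>t. Gamma (Complex g t) * z powr (- Complex g t)) \<in> borel_measurable lborel"
      using z0 by (simp add: powr_def borel_measurable_continuous_onI)
    have "cmod (Gamma (Complex g t) * z powr (- Complex g t)) \<le> C * cmod z powr (- g) * exp (- k * \<bar>t\<bar>)" for t
    proof -
      have "t * Arg z \<le> \<bar>t\<bar> * \<bar>Arg z\<bar>" using abs_ge_self[of "t * Arg z"] by (simp add: abs_mult)
      hence "cmod (Gamma (Complex g t) * z powr (- Complex g t)) \<le> (C * exp (- p * \<bar>t\<bar>)) * (cmod z powr (- g) * exp (\<bar>t\<bar> * \<bar>Arg z\<bar>))"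
        unfolding norm_mult norm_powr_complex
        by (intro mult_mono C mult_left_mono order.trans[OF _ C]) auto
      also have "\<dots> = C * cmod z powr (- g) * exp (- k * \<bar>t\<bar>)"
        by (simp add: k_def algebra_simps exp_add exp_diff exp_minus field_simps)
      finally show ?thesis .
    qed
    thus "AE t in lborel. norm (Gamma (Complex g t) * z powr (- Complex g t)) \<le> norm (C * cmod z powr (- g) * exp (- k * \<bar>t\<bar>))"
      by (auto intro: order.trans[OF _ abs_ge_self])
  qed
qed

section \<open>The Gamma integral in logarithmic coordinates\<close>

lemma integral_exp_substitution:
  fixes f :: "real \<Rightarrow> complex"
  assumes f: "set_integrable lborel {0<..} f"
  shows "integrable lborel (\<lambda>u. exp u *\<^sub>R f (exp u))"
    and "(\<integral>u. exp u *\<^sub>R f (exp u) \<partial>lborel) = (LINT y:{0<..}|lborel. f y)"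
proof -
  have rg: "range exp = {0::real<..}"
    by (auto simp: image_def intro: exp_gt_zero) (metis exp_ln)
  \<comment> \<open>The change of variables is done for real-valued integrands; the complex
    statement follows from the real and imaginary parts.\<close>
  have real: "integrable lborel (\<lambda>u. exp u * h (exp u)) \<and> (\<integral>u. exp u * h (exp u) \<partial>lborel) = (LINT y:{0<..}|lborel. h y)"
    if h: "set_integrable lborel {0<..} h" for h :: "real \<Rightarrow> real"
  proof -
    have measg: "(\<lambda>y. indicator {0<..} y *\<^sub>R h y) \<in> borel_measurable borel"
      using h by (auto simp: set_integrable_def)
    \<comment> \<open>Only the restriction of \<open>h\<close> to the positive reals is known to be
      Borel measurable. The indicator disappears after composition because
      \<open>exp u > 0\<close>.\<close>
    have "(\<lambda>u. exp u *\<^sub>R (indicator {0<..} (exp u) *\<^sub>R h (exp u))) \<in> borel_measurable lborel"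
      using measurable_compose[OF _ measg, of exp lborel] by measurable
    hence measg': "(\<lambda>u. exp u * h (exp u)) \<in> borel_measurable lborel" by simp
    have hab: "h absolutely_integrable_on {0<..}"
      using h unfolding set_integrable_def by (simp add: integrable_completion measg)
    have hval: "integral {0<..} h = (LINT y:{0<..}|lborel. h y)"
      using set_lebesgue_integral_eq_integral(2)[OF hab] measg
      by (simp add: set_lebesgue_integral_def integral_completion)
    have "(\<lambda>u. \<bar>exp u\<bar> * h (exp u)) absolutely_integrable_on UNIV \<and>
          integral UNIV (\<lambda>u. \<bar>exp u\<bar> * h (exp u)) = integral {0<..} h"
      using hab has_absolute_integral_change_of_variables_1'[of UNIV exp exp h "integral {0<..} h"]
      by (simp add: rg DERIV_exp inj_def)
    hence ab: "(\<lambda>u. exp u * h (exp u)) absolutely_integrable_on UNIV"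
      and val: "integral UNIV (\<lambda>u. exp u * h (exp u)) = (LINT y:{0<..}|lborel. h y)"
      using hval by auto
    from ab have i: "integrable lborel (\<lambda>u. exp u * h (exp u))"
      unfolding set_integrable_def using measg' by (simp add: integrable_completion)
    moreover have "(\<integral>u. exp u * h (exp u) \<partial>lborel) = integral UNIV (\<lambda>u. exp u * h (exp u))"
      using set_lebesgue_integral_eq_integral(2)[OF ab] measg'
      by (simp add: set_lebesgue_integral_def integral_completion)
    ultimately show ?thesis using val by simp
  qed
  have Re: "set_integrable lborel {0<..} (\<lambda>y. Re (f y))" and Im: "set_integrable lborel {0<..} (\<lambda>y. Im (f y))"
    using integrable_Re[OF f[unfolded set_integrable_def]] integrable_Im[OF f[unfolded set_integrable_def]]
    by (simp_all add: set_integrable_def)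
  show i: "integrable lborel (\<lambda>u. exp u *\<^sub>R f (exp u))"
  proof -
    have "integrable lborel (\<lambda>u. complex_of_real (exp u * Re (f (exp u))) + \<i> * complex_of_real (exp u * Im (f (exp u))))"
      using real[OF Re] real[OF Im]
      by (intro Bochner_Integration.integrable_add integrable_mult_right integrable_of_real) auto
    also have "(\<lambda>u. complex_of_real (exp u * Re (f (exp u))) + \<i> * complex_of_real (exp u * Im (f (exp u)))) = (\<lambda>u. exp u *\<^sub>R f (exp u))"
      by (auto simp: complex_eq_iff)
    finally show ?thesis .
  qed
  have if': "integrable lborel (\<lambda>y. indicator {0<..} y *\<^sub>R f y)" using f by (simp add: set_integrable_def)
  show "(\<integral>u. exp u *\<^sub>R f (exp u) \<partial>lborel) = (LINT y:{0<..}|lborel. f y)"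
    using real[OF Re] real[OF Im]
    by (simp add: complex_eq_iff set_lebesgue_integral_def flip: integral_Re[OF i] integral_Im[OF i] integral_Re[OF if'] integral_Im[OF if'])
qed

text \<open>With u = ln y and x = g + it the Gamma integral becomes the Fourier integral in t of exp
  (g u - z exp u), the form to which Fourier inversion applies.\<close>

lemma Gamma_integral_log:
  fixes x z :: complex
  assumes x: "Re x > 0" and z: "Re z > 0"
  shows "integrable lborel (\<lambda>u. exp (x * of_real u - z * of_real (exp u)))"
    and "(\<integral>u. exp (x * of_real u - z * of_real (exp u)) \<partial>lborel) = Gamma x * z powr (- x)"
proof -
  have eq: "exp u *\<^sub>R (complex_of_real (exp u) powr (x - 1) * exp (- (z * of_real (exp u)))) =
      exp (x * of_real u - z * of_real (exp u))" for u
    by (simp add: powr_def scaleR_conv_of_real Ln_of_real algebra_simps flip: exp_add exp_of_real)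
  note G = Gamma_integral_complex_rate[OF x z]
  show "integrable lborel (\<lambda>u. exp (x * of_real u - z * of_real (exp u)))"
    using integral_exp_substitution(1)[OF G(1)] unfolding eq .
  show "(\<integral>u. exp (x * of_real u - z * of_real (exp u)) \<partial>lborel) = Gamma x * z powr (- x)"
    using integral_exp_substitution(2)[OF G(1)] unfolding eq G(2) .
qed

subsection \<open>The Cahen-Mellin integral and the Fox H-function\<close>

lemma Fourier_inversion_at_0:
  fixes h :: "real \<Rightarrow> complex"
  defines "H \<equiv> \<lambda>t. \<integral>u. h u * iexp (t * u) \<partial>lborel"
  assumes h: "integrable lborel h" and H: "integrable lborel H"
    and cont: "isCont h 0" and bdd: "\<And>u. norm (h u) \<le> B"
  shows "(\<integral>t. H t \<partial>lborel) = 2 * pi * h 0"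
proof -
  interpret N: real_distribution std_normal_distribution by (rule real_dist_normal_dist)
  interpret P: pair_sigma_finite lborel std_normal_distribution ..
  define g where "g = (\<lambda>x::real. exp (- x\<^sup>2 / 2))"
  have [measurable]: "h \<in> borel_measurable borel" "H \<in> borel_measurable borel" "g \<in> borel_measurable borel"
    using h H by (auto simp: g_def)
  have dens: "std_normal_density x = g x / sqrt (2 * pi)" for x
    by (simp add: std_normal_density_def g_def)
  have gnn: "0 \<le> g x / sqrt (2 * pi)" for x by (simp add: g_def)
  \<comment> \<open>Fubini against a Gaussian, which is its own characteristic function up to scaling.\<close>
  have smoothed: "(\<integral>t. g (e * t) *\<^sub>R H t \<partial>lborel) = 2 * pi * (\<integral>x. h (e * x) \<partial>std_normal_distribution)"
    if e: "e > 0" for e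
  proof -
    have int: "integrable (lborel \<Otimes>\<^sub>M std_normal_distribution) (\<lambda>(u, x). h u * iexp (x / e * u))"
    proof (rule P.Fubini_integrable)
      show "(\<lambda>(u, x). h u * iexp (x / e * u)) \<in> borel_measurable (lborel \<Otimes>\<^sub>M std_normal_distribution)"
        by measurable
      show "integrable lborel (\<lambda>u. \<integral>x. norm (case (u, x) of (u, x) \<Rightarrow> h u * iexp (x / e * u)) \<partial>std_normal_distribution)"
        using h by (simp add: norm_mult N.prob_space[simplified] flip: of_real_mult)
      show "AE u in lborel. integrable std_normal_distribution (\<lambda>x. case (u, x) of (u, x) \<Rightarrow> h u * iexp (x / e * u))"
        using N.integrable_iexp[of "\<lambda>x. complex_of_real (x / e * u)" for u] by (intro AE_I2) (auto intro!: integrable_mult_right)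
    qed
    have "(\<integral>x. H (x / e) \<partial>std_normal_distribution) = (\<integral>u. (\<integral>x. h u * iexp (x / e * u) \<partial>std_normal_distribution) \<partial>lborel)"
      unfolding H_def using P.Fubini_integral[OF int] by simp
    also have "\<dots> = (\<integral>u. g (u / e) *\<^sub>R h u \<partial>lborel)"
    proof (intro Bochner_Integration.integral_cong refl)
      fix u
      have "(\<integral>x. h u * iexp (x / e * u) \<partial>std_normal_distribution) = h u * char std_normal_distribution (u / e)"
        unfolding char_def by (simp add: field_simps)
      thus "(\<integral>x. h u * iexp (x / e * u) \<partial>std_normal_distribution) = g (u / e) *\<^sub>R h u"
        by (simp add: char_std_normal_distribution g_def scaleR_conv_of_real)
    qed
    also have "\<dots> = e *\<^sub>R (\<integral>u. g u *\<^sub>R h (e * u) \<partial>lborel)"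
      using e by (subst lborel_integral_real_affine[of e _ 0]) auto
    also have "(\<integral>u. g u *\<^sub>R h (e * u) \<partial>lborel) = sqrt (2 * pi) *\<^sub>R (\<integral>x. h (e * x) \<partial>std_normal_distribution)"
    proof -
      have "(\<integral>x. h (e * x) \<partial>std_normal_distribution) = (\<integral>u. (g u / sqrt (2 * pi)) *\<^sub>R h (e * u) \<partial>lborel)"
        by (subst integral_density) (auto simp: dens[abs_def] gnn)
      also have "\<dots> = (\<integral>u. (1 / sqrt (2 * pi)) *\<^sub>R (g u *\<^sub>R h (e * u)) \<partial>lborel)" by simp
      also have "\<dots> = (1 / sqrt (2 * pi)) *\<^sub>R (\<integral>u. g u *\<^sub>R h (e * u) \<partial>lborel)"
        by (rule integral_scaleR_right)
      finally show ?thesis by simp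
    qed
    finally have "(\<integral>x. H (x / e) \<partial>std_normal_distribution) = (e * sqrt (2 * pi)) *\<^sub>R (\<integral>x. h (e * x) \<partial>std_normal_distribution)"
      by simp
    moreover have "(\<integral>x. H (x / e) \<partial>std_normal_distribution) = (\<integral>x. (g x / sqrt (2 * pi)) *\<^sub>R H (x / e) \<partial>lborel)"
      by (subst integral_density) (auto simp: dens[abs_def] gnn)
    moreover have "\<dots> = e *\<^sub>R (\<integral>t. (g (e * t) / sqrt (2 * pi)) *\<^sub>R H t \<partial>lborel)"
      using e by (subst lborel_integral_real_affine[of e _ 0]) auto
    moreover have "(\<integral>t. (g (e * t) / sqrt (2 * pi)) *\<^sub>R H t \<partial>lborel) = (\<integral>t. (1 / sqrt (2 * pi)) *\<^sub>R (g (e * t) *\<^sub>R H t) \<partial>lborel)"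
      by simp
    moreover have "\<dots> = (1 / sqrt (2 * pi)) *\<^sub>R (\<integral>t. g (e * t) *\<^sub>R H t \<partial>lborel)"
      by (rule integral_scaleR_right)
    ultimately have "(e / sqrt (2 * pi)) *\<^sub>R (\<integral>t. g (e * t) *\<^sub>R H t \<partial>lborel) = (e * sqrt (2 * pi)) *\<^sub>R (\<integral>x. h (e * x) \<partial>std_normal_distribution)"
      by (simp only: scaleR_scaleR) simp
    \<comment> \<open>The left side carries e / sqrt (2 pi) and the right side e sqrt (2 pi); their
      quotient is the factor 2 pi of the inversion formula.\<close>
    hence "(sqrt (2 * pi) / e) *\<^sub>R ((e / sqrt (2 * pi)) *\<^sub>R (\<integral>t. g (e * t) *\<^sub>R H t \<partial>lborel)) =
        (sqrt (2 * pi) / e) *\<^sub>R ((e * sqrt (2 * pi)) *\<^sub>R (\<integral>x. h (e * x) \<partial>std_normal_distribution))" by (rule arg_cong)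
    moreover have "sqrt (2 * pi) / e * (e / sqrt (2 * pi)) = 1" "sqrt (2 * pi) / e * (e * sqrt (2 * pi)) = 2 * pi"
      using e by simp_all
    ultimately show ?thesis by (simp only: scaleR_scaleR scaleR_one) (simp add: scaleR_conv_of_real)
  qed
  \<comment> \<open>As \<open>e n\<close> tends to 0, the Gaussian weight on the left tends to 1
    with |H| as dominating function. On the right \<open>h (e n * x)\<close> tends to
    \<open>h 0\<close> with the bound \<open>B\<close>.\<close>
  define e where "e = (\<lambda>n. 1 / real (Suc n))"
  have e: "e n > 0" for n by (simp add: e_def)
  have e0: "e \<longlonglongrightarrow> 0" unfolding e_def by (rule LIMSEQ_Suc[OF lim_1_over_n])
  have ex0: "(\<lambda>n. e n * x) \<longlonglongrightarrow> 0" for x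
    using tendsto_mult_right[OF e0, of x] by simp
  have gle: "\<bar>g x\<bar> \<le> 1" for x by (simp add: g_def)
  have "isCont g 0" by (simp add: g_def)
  hence glim: "(\<lambda>n. g (e n * x)) \<longlonglongrightarrow> 1" for x
    using isCont_tendsto_compose[OF _ ex0, of g x] by (simp add: g_def)
  have "(\<lambda>n. \<integral>t. g (e n * t) *\<^sub>R H t \<partial>lborel) \<longlonglongrightarrow> (\<integral>t. H t \<partial>lborel)"
  proof (rule integral_dominated_convergence)
    show "integrable lborel (\<lambda>t. norm (H t))" using H by (rule integrable_norm)
    show "AE t in lborel. (\<lambda>n. g (e n * t) *\<^sub>R H t) \<longlonglongrightarrow> H t"
      using tendsto_scaleR[OF glim tendsto_const] by auto
    show "AE t in lborel. norm (g (e n * t) *\<^sub>R H t) \<le> norm (H t)" for n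
      using gle by (auto intro!: mult_left_le_one_le)
  qed auto
  moreover have "(\<lambda>n. \<integral>t. g (e n * t) *\<^sub>R H t \<partial>lborel) \<longlonglongrightarrow> 2 * pi * (\<integral>x. h 0 \<partial>std_normal_distribution)"
    unfolding smoothed[OF e]
  proof (intro tendsto_mult_left integral_dominated_convergence)
    show "integrable std_normal_distribution (\<lambda>_. B)" by simp
    show "AE x in std_normal_distribution. (\<lambda>n. h (e n * x)) \<longlonglongrightarrow> h 0"
      using isCont_tendsto_compose[OF cont ex0] by auto
    show "AE x in std_normal_distribution. norm (h (e n * x)) \<le> B" for n
      using bdd by auto
  qed auto
  ultimately have "(\<integral>t. H t \<partial>lborel) = 2 * pi * (\<integral>x. h 0 \<partial>std_normal_distribution)"
    by (rule LIMSEQ_unique)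
  also have "(\<integral>x. h 0 \<partial>std_normal_distribution) = h 0"
    using N.prob_space by simp
  finally show ?thesis .
qed

lemma Cahen_Mellin:
  fixes g :: real and z :: complex
  assumes g: "g > 0" and z: "Re z > 0"
  shows "(\<integral>t. Gamma (Complex g t) * z powr (- Complex g t) \<partial>lborel) = 2 * pi * exp (- z)"
proof -
  define h where "h = (\<lambda>u. exp (of_real g * of_real u - z * of_real (exp u)))"
  have H: "(\<integral>u. h u * iexp (t * u) \<partial>lborel) = Gamma (Complex g t) * z powr (- Complex g t)" for t
  proof -
    have "h u * iexp (t * u) = exp (Complex g t * of_real u - z * of_real (exp u))" for u
      by (simp add: h_def Complex_eq algebra_simps flip: exp_add)
    thus ?thesis using Gamma_integral_log(2)[of "Complex g t" z] g z by simp
  qed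
  have h: "integrable lborel h"
    using Gamma_integral_log(1)[of "of_real g" z] g z by (simp add: h_def)
  \<comment> \<open>\<open>B\<close> is the maximum over u of exp (g u - Re z exp u), attained at
    exp u = g / Re z. The inequality ln x <= x - 1 proves the bound without calculus.\<close>
  define B where "B = exp (g * ln (g / Re z) - g)"
  have bdd: "norm (h u) \<le> B" for u
  proof -
    have "ln (Re z * exp u / g) \<le> Re z * exp u / g - 1"
      using g z by (intro ln_le_minus_one) auto
    hence "u \<le> Re z * exp u / g - 1 + ln (g / Re z)"
      using g z by (simp add: ln_mult ln_div)
    from mult_left_mono[OF this, of g] have "g * u - Re z * exp u \<le> g * ln (g / Re z) - g"
      using g by (simp add: algebra_simps)
    thus ?thesis by (simp add: h_def B_def)
  qed
  have "isCont h 0" unfolding h_def by (intro continuous_intros)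
  from Fourier_inversion_at_0[OF h _ this bdd] integrable_Gamma_powr_vertical[OF g z]
  show ?thesis unfolding H by (simp add: h_def)
qed

text \<open>The hypothesis on \<open>Ln\<close> is what splits (B A^(-alpha/2))^(-xi) into B^(-xi)
  A^(alpha xi/2), which principal branches do not grant in general; \<open>Ln_times_powr_eq\<close>
  supplies it later. The bound g < 2/alpha keeps Re (1 - alpha xi/2) > 0, so that the inner Gamma
  integral converges.\<close>

lemma Laplace_stretched_exponential_eq_fox_H:
  fixes A B :: complex and alpha g :: real
  assumes alpha: "alpha > 0" and g: "g > 0" "g < 2 / alpha" and A: "Re A > 0" and B: "Re B > 0"
    and Ln: "Ln (B * A powr of_real (- alpha / 2)) = Ln B - of_real (alpha / 2) * Ln A"
  shows "(LINT y:{0<..}|lborel. exp (- (A * of_real y) - B * of_real (y powr (alpha / 2)))) =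
           fox_H alpha g (B * A powr of_real (- alpha / 2)) / A"
proof -
  define b where "b = alpha / 2"
  have b: "b > 0" "b * g < 1" using alpha g by (auto simp: b_def field_simps)
  have A0: "A \<noteq> 0" and B0: "B \<noteq> 0" using A B by auto
  define G where "G = (\<lambda>t. Gamma (Complex g t) * B powr (- Complex g t))"
  define E where "E = (\<lambda>y t. indicator {0<..} y *\<^sub>R (of_real y powr (- (of_real b * Complex g t)) * exp (- (A * of_real y))))"
  have G: "integrable lborel G" unfolding G_def by (rule integrable_Gamma_powr_vertical[OF g(1) B])
  have [measurable]: "G \<in> borel_measurable borel" using G by auto
  have [measurable]: "Complex g \<in> borel_measurable borel"
    unfolding Complex_eq[abs_def] by measurable
  have rez: "Re (1 - of_real b * Complex g t) > 0" for t using b by simp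
  have E: "integrable lborel (\<lambda>y. E y t)"
    "(\<integral>y. E y t \<partial>lborel) = Gamma (1 - of_real b * Complex g t) * A powr (of_real b * Complex g t - 1)" for t
    using Gamma_integral_complex_rate[OF rez A, of t]
    by (simp_all add: E_def set_integrable_def set_lebesgue_integral_def)
  \<comment> \<open>On a vertical line the modulus of y^(-b xi) depends on Re xi only. Hence the
    modulus of \<open>E\<close> is free of \<open>t\<close>, and the double integral of moduli
    factorises into those of \<open>F\<close> and \<open>G\<close>.\<close>
  define F where "F = (\<lambda>y. norm (E y 0))"
  have Enorm: "norm (E y t) = F y" for y t
    by (auto simp: E_def F_def indicator_def norm_mult norm_powr_real_powr)
  have F: "integrable lborel F" unfolding F_def by (intro integrable_norm E)
  have int: "integrable (lborel \<Otimes>\<^sub>M lborel) (\<lambda>(y, t). E y t * G t)"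
  proof (rule lborel_pair.Fubini_integrable)
    show "(\<lambda>(y, t). E y t * G t) \<in> borel_measurable (lborel \<Otimes>\<^sub>M lborel)"
      unfolding E_def by measurable
    have "integrable lborel (\<lambda>y. F y * (\<integral>t. norm (G t) \<partial>lborel))"
      by (intro integrable_mult_left F)
    thus "integrable lborel (\<lambda>y. \<integral>t. norm (case (y, t) of (y, t) \<Rightarrow> E y t * G t) \<partial>lborel)"
      by (simp add: norm_mult Enorm)
    show "AE y in lborel. integrable lborel (\<lambda>t. case (y, t) of (y, t) \<Rightarrow> E y t * G t)"
    proof (intro AE_I2)
      fix y
      have "integrable lborel (\<lambda>t. E y t * G t)"
      proof (rule Bochner_Integration.integrable_bound)
        show "integrable lborel (\<lambda>t. F y * norm (G t))"
          by (intro integrable_mult_right integrable_norm G)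
        show "(\<lambda>t. E y t * G t) \<in> borel_measurable lborel" unfolding E_def by measurable
        show "AE t in lborel. norm (E y t * G t) \<le> norm (F y * norm (G t))"
          by (auto simp: norm_mult Enorm intro: order.trans[OF _ abs_ge_self])
      qed
      thus "integrable lborel (\<lambda>t. case (y, t) of (y, t) \<Rightarrow> E y t * G t)" by simp
    qed
  qed
  have inner: "(\<integral>t. E y t * G t \<partial>lborel) =
     2 * pi * (indicator {0<..} y *\<^sub>R exp (- (A * of_real y) - B * of_real (y powr b)))" for y
  proof (cases "y > 0")
    case True
    have "Re (of_real (y powr b) * B) > 0" using True B by simp
    note CM = Cahen_Mellin[OF g(1) this]
    have "E y t * G t = exp (- (A * of_real y)) * (Gamma (Complex g t) * (of_real (y powr b) * B) powr (- Complex g t))" for t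
    proof -
      have "(of_real (y powr b) * B) powr (- Complex g t) = of_real (y powr b) powr (- Complex g t) * B powr (- Complex g t)"
        using True by (intro powr_times_real_left) auto
      also have "complex_of_real (y powr b) powr (- Complex g t) = of_real y powr (- (of_real b * Complex g t))"
        using True by (simp add: powr_def Ln_of_real ln_powr mult_ac flip: exp_of_real)
      finally show ?thesis using True by (simp add: E_def G_def)
    qed
    hence "(\<integral>t. E y t * G t \<partial>lborel) = exp (- (A * of_real y)) * (2 * pi * exp (- (of_real (y powr b) * B)))"
      using CM by simp
    thus ?thesis using True by (simp add: exp_diff exp_minus field_simps)
  qed (simp add: E_def)
  have Gam: "of_real (1 / (2 * pi)) * (\<integral>t. (\<integral>y. E y t * G t \<partial>lborel) \<partial>lborel) =
      fox_H alpha g (B * A powr of_real (- alpha / 2)) / A"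
  proof -
    let ?x = "B * A powr of_real (- alpha / 2)"
    have x0: "?x \<noteq> 0" using A0 B0 by simp
    have "(\<integral>y. E y t * G t \<partial>lborel) =
       Gamma (Complex g t) * Gamma (1 - complex_of_real (alpha / 2) * Complex g t) * ?x powr (- Complex g t) / A" for t
    proof -
      have "?x powr (- Complex g t) = B powr (- Complex g t) * A powr (of_real b * Complex g t)"
        using x0 A0 B0 unfolding powr_def[of ?x] Ln
        by (simp add: powr_def b_def algebra_simps flip: exp_add)
      thus ?thesis using A0 E by (simp add: G_def powr_diff b_def)
    qed
    thus ?thesis using x0 by (simp add: fox_H_def)
  qed
  have "2 * pi * (LINT y:{0<..}|lborel. exp (- (A * of_real y) - B * of_real (y powr b))) = (\<integral>y. (\<integral>t. E y t * G t \<partial>lborel) \<partial>lborel)"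
    unfolding inner set_lebesgue_integral_def by (simp only: integral_mult_right_zero)
  also have "\<dots> = (\<integral>t. (\<integral>y. E y t * G t \<partial>lborel) \<partial>lborel)"
    using lborel_pair.Fubini_integral[OF int] by simp
  finally have "(LINT y:{0<..}|lborel. exp (- (A * of_real y) - B * of_real (y powr b))) =
      of_real (1 / (2 * pi)) * (\<integral>t. (\<integral>y. E y t * G t \<partial>lborel) \<partial>lborel)"
    by (simp add: field_simps)
  thus ?thesis unfolding Gam b_def .
qed

lemma Ln_times_powr_eq:
  fixes s :: complex and alpha q x y :: real
  assumes alpha: "alpha > 2" and s: "Re s > 0" and q: "q > 0" and xy: "x > 0" "y > 0"
  defines "v \<equiv> s powr of_real (2 / alpha)"
  defines "A \<equiv> of_real x + of_real y * v"
  shows "Re v > 0" and "Ln (of_real q * s * A powr of_real (- alpha / 2)) = Ln (of_real q * s) - of_real (alpha / 2) * Ln A"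
proof -
  have s0: "s \<noteq> 0" using s by auto
  have Args: "\<bar>Arg s\<bar> < pi / 2" using s Arg_Re_pos by blast
  have v0: "v \<noteq> 0" using s0 by (simp add: v_def)
  \<comment> \<open>Since 2/alpha < 1, taking this power shrinks the argument, so \<open>v\<close>
    stays in the right half-plane.\<close>
  have "\<bar>2 / alpha * Arg s\<bar> \<le> \<bar>Arg s\<bar>"
    using alpha mult_left_mono[of 2 alpha "\<bar>Arg s\<bar>"] by (simp add: abs_mult field_simps)
  hence b: "\<bar>2 / alpha * Arg s\<bar> < pi / 2" using Args by linarith
  have Argv: "Arg v = 2 / alpha * Arg s"
  proof -
    have "v = exp (of_real (2 / alpha) * Ln s)" using s0 by (simp add: v_def powr_def)
    hence "Ln v = of_real (2 / alpha) * Ln s"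
      using b s0 by (simp only:) (rule Ln_exp, auto simp: Arg_eq_Im_Ln abs_if split: if_splits)
    thus ?thesis using v0 s0 by (simp add: Arg_eq_Im_Ln)
  qed
  show v: "Re v > 0"
    using b v0 Arg_Re_pos[of v] unfolding Argv by blast
  have ReA: "Re A > 0" using v xy by (simp add: A_def add_pos_pos)
  hence A0: "A \<noteq> 0" by auto
  \<comment> \<open>Adding a positive real to \<open>y v\<close> moves it towards the positive axis; hence
    \<open>\<bar>alpha / 2 * Arg A\<bar> \<le> \<bar>Arg s\<bar>\<close> and no branch cut is crossed.\<close>
  have "\<bar>Arg A\<bar> \<le> \<bar>Arg v\<bar>"
  proof -
    \<comment> \<open>Cosine decreases on [0, pi], so comparing the arguments amounts to comparing
      Re / modulus, which the triangle inequality settles.\<close>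
    have "cos \<bar>Arg v\<bar> = Re v / cmod v" using cos_Arg[OF v0] by simp
    also have "\<dots> \<le> Re A / cmod A"
    proof -
      have "cmod A \<le> x + y * cmod v"
        using norm_triangle_ineq[of "of_real x" "of_real y * v"] xy by (simp add: A_def norm_mult)
      hence "Re v * cmod A \<le> Re v * (x + y * cmod v)" using v by (intro mult_left_mono) auto
      also have "\<dots> \<le> x * cmod v + Re v * y * cmod v"
        using xy complex_Re_le_cmod[of v] by (simp add: algebra_simps)
      also have "\<dots> = Re A * cmod v" by (simp add: A_def algebra_simps)
      finally show ?thesis using A0 v0 by (simp add: field_simps)
    qed
    also have "\<dots> = cos \<bar>Arg A\<bar>" using cos_Arg[OF A0] by simp
    finally show ?thesis
      using Arg_bounded[of A] Arg_bounded[of v] by (subst (asm) cos_mono_le_eq) auto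
  qed
  hence "\<bar>alpha / 2 * Arg A\<bar> \<le> \<bar>Arg s\<bar>"
    using alpha unfolding Argv by (simp add: abs_mult field_simps)
  hence bound: "\<bar>Arg s - alpha / 2 * Arg A\<bar> < pi" using Args by linarith
  have Lnq: "Im (Ln (of_real q * s)) = Arg s"
    using q s0 by (simp add: Ln_times_of_real Arg_eq_Im_Ln Im_Ln_of_real)
  have "of_real q * s * A powr of_real (- alpha / 2) = exp (Ln (of_real q * s) - of_real (alpha / 2) * Ln A)"
  proof -
    have "A powr of_real (- alpha / 2) = exp (- (of_real (alpha / 2) * Ln A))"
      using A0 by (simp add: powr_def)
    moreover have "exp (Ln (of_real q * s)) = of_real q * s"
      using q s0 by (intro exp_Ln) simp
    ultimately show ?thesis by (simp only: diff_conv_add_uminus exp_add)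
  qed
  also have "Ln \<dots> = Ln (of_real q * s) - of_real (alpha / 2) * Ln A"
    using bound A0 by (intro Ln_exp) (auto simp: Lnq Arg_eq_Im_Ln abs_if split: if_splits)
  finally show "Ln (of_real q * s * A powr of_real (- alpha / 2)) = Ln (of_real q * s) - of_real (alpha / 2) * Ln A" .
qed

subsection \<open>Order statistics\<close>

text \<open>In a sorted list the entries below the threshold form a prefix, and an index lies in
  that prefix iff it is less than its length.\<close>

lemma sorted_nth_le_iff_less_length_filter:
  fixes xs :: "'a::linorder list"
  assumes "sorted xs" "k < length xs"
  shows "xs ! k \<le> x \<longleftrightarrow> k < length (filter (\<lambda>y. y \<le> x) xs)"
  using assms
proof (induction xs arbitrary: k)
  case (Cons a xs)
  show ?case
  proof (cases "a \<le> x")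
    case True
    thus ?thesis using Cons by (cases k) auto
  next
    case False
    have "\<forall>y\<in>set (a # xs). \<not> y \<le> x" using False Cons.prems by auto
    moreover from this have "filter (\<lambda>y. y \<le> x) (a # xs) = []" by (simp only: filter_False)
    ultimately show ?thesis using nth_mem[OF Cons.prems(2)] by auto
  qed
qed simp

text \<open>This turns an event about the sorted list into a counting event about the unsorted
  variables, where independence can be used. The zero-based index \<open>r - 1\<close> turns the
  strict bound on the count into r <= count.\<close>

lemma rth_smallest_le_iff:
  assumes "1 \<le> r" "r \<le> n"
  shows "rth_smallest r D n w \<le> x \<longleftrightarrow> r \<le> card {i \<in> {1..n}. D i w \<le> x}"
proof -
  let ?xs = "map (\<lambda>i. D i w) [1..<n+1]"
  have "rth_smallest r D n w \<le> x \<longleftrightarrow> r - 1 < length (filter (\<lambda>y. y \<le> x) (sort ?xs))"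
    unfolding rth_smallest_def using assms by (intro sorted_nth_le_iff_less_length_filter) auto
  also have "length (filter (\<lambda>y. y \<le> x) (sort ?xs)) = length (filter (\<lambda>y. y \<le> x) ?xs)"
    by (metis mset_filter mset_sort size_mset)
  also have "\<dots> = length (filter (\<lambda>i. D i w \<le> x) [1..<n+1])"
    by (simp add: filter_map o_def del: upt_Suc)
  also have "\<dots> = card (set (filter (\<lambda>i. D i w \<le> x) [1..<n+1]))"
    by (rule distinct_card[symmetric]) simp
  also have "set (filter (\<lambda>i. D i w \<le> x) [1..<n+1]) = {i \<in> {1..n}. D i w \<le> x}"
    by auto
  finally show ?thesis using assms by auto
qed

definition binomial_tail :: "nat \<Rightarrow> nat \<Rightarrow> real \<Rightarrow> real" where
  "binomial_tail n r p = (\<Sum>k = r..n. real (n choose k) * p ^ k * (1 - p) ^ (n - k))"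

lemma binomial_tail_0: "1 \<le> r \<Longrightarrow> binomial_tail n r 0 = 0"
  unfolding binomial_tail_def by (intro sum.neutral) auto

text \<open>Differentiating termwise, consecutive terms telescope.\<close>

lemma has_real_derivative_binomial_tail:
  assumes "r \<le> n"
  shows "(binomial_tail n r has_real_derivative real r * real (n choose r) * p ^ (r - 1) * (1 - p) ^ (n - r)) (at p)"
  using assms
proof (induction r rule: inc_induct)
  case base
  have "binomial_tail n n = (\<lambda>p. p ^ n)" by (simp add: binomial_tail_def fun_eq_iff)
  thus ?case by (auto intro!: derivative_eq_intros)
next
  case (step r)
  have "binomial_tail n r = (\<lambda>p. real (n choose r) * p ^ r * (1 - p) ^ (n - r) + binomial_tail n (Suc r) p)"
    using step by (simp add: binomial_tail_def fun_eq_iff sum.atLeast_Suc_atMost)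
  \<comment> \<open>By this identity the derivative of the (1 - p) factor cancels against the
    induction hypothesis for \<open>Suc r\<close>.\<close>
  moreover have "real (Suc r) * real (n choose Suc r) = real (n - r) * real (n choose r)"
    by (metis binomial_absorb_comp binomial_absorption mult.commute of_nat_mult)
  moreover have "((\<lambda>p. real (n choose r) * p ^ r * (1 - p) ^ (n - r) + binomial_tail n (Suc r) p) has_real_derivative
     (real (n choose r) * (real r * p ^ (r - 1)) * (1 - p) ^ (n - r) - real (n choose r) * p ^ r * (real (n - r) * (1 - p) ^ (n - r - 1))
     + real (Suc r) * real (n choose Suc r) * p ^ (Suc r - 1) * (1 - p) ^ (n - Suc r))) (at p)"
    by (rule derivative_eq_intros step.IH refl | simp)+
  ultimately show ?case by (simp add: algebra_simps)
qed

context prob_space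
begin

text \<open>Split the event by the exact set S of indices with X i <= x. Independence gives each
  piece the probability p^|S| (1-p)^(|I|-|S|), and grouping the sets by size produces the binomial
  coefficients.\<close>

lemma prob_card_le_eq_binomial_tail:
  fixes X :: "nat \<Rightarrow> 'a \<Rightarrow> real"
  assumes indep: "indep_vars (\<lambda>_. borel) X I" and fin: "finite I" and ne: "I \<noteq> {}"
    and p: "\<And>i. i \<in> I \<Longrightarrow> prob {w \<in> space M. X i w \<le> x} = p"
  shows "{w \<in> space M. r \<le> card {i \<in> I. X i w \<le> x}} \<in> events"
    and "prob {w \<in> space M. r \<le> card {i \<in> I. X i w \<le> x}} = binomial_tail (card I) r p"
proof -
  have X [measurable]: "i \<in> I \<Longrightarrow> X i \<in> borel_measurable M" for i
    using indep by (auto simp: indep_vars_def)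
  define A where "A = (\<lambda>S. {w \<in> space M. {i \<in> I. X i w \<le> x} = S})"
  have A_eq: "A S = (\<Inter>i\<in>I. X i -` (if i \<in> S then {..x} else {x<..}) \<inter> space M)" if "S \<subseteq> I" for S
    using that ne by (auto simp: A_def not_le split: if_splits)
  have A_ev: "A S \<in> events" if "S \<subseteq> I" for S
    unfolding A_eq[OF that] using fin ne by (intro sets.finite_INT) (auto intro!: measurable_sets[OF X])
  have A_prob: "prob (A S) = p ^ card S * (1 - p) ^ (card I - card S)" if S: "S \<subseteq> I" for S
  proof -
    have compl: "prob (X i -` {x<..} \<inter> space M) = 1 - p" if i: "i \<in> I" for i
    proof -
      have "X i -` {x<..} \<inter> space M = space M - {w \<in> space M. X i w \<le> x}" by auto
      thus ?thesis using i p by (simp add: prob_compl)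
    qed
    have le: "prob (X i -` {..x} \<inter> space M) = p" if i: "i \<in> I" for i
      using p[OF i] by (simp add: vimage_def Int_def conj_commute)
    have "prob (A S) = (\<Prod>i\<in>I. prob (X i -` (if i \<in> S then {..x} else {x<..}) \<inter> space M))"
      unfolding A_eq[OF S] using ne fin by (intro indep_varsD_finite[OF indep]) auto
    also have "\<dots> = (\<Prod>i\<in>I. if i \<in> S then p else 1 - p)"
      by (intro prod.cong refl) (auto simp: compl le)
    also have "\<dots> = p ^ card S * (1 - p) ^ card (I - S)"
      using fin S by (simp add: prod.If_cases Int_absorb1 Diff_eq)
    finally show ?thesis using S fin by (simp add: card_Diff_subset finite_subset)
  qed
  define \<S> where "\<S> = {S. S \<subseteq> I \<and> r \<le> card S}"
  have fin\<S>: "finite \<S>" using fin by (simp add: \<S>_def)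
  have eq: "{w \<in> space M. r \<le> card {i \<in> I. X i w \<le> x}} = (\<Union>S\<in>\<S>. A S)"
  proof -
    have "(\<Union>S\<in>\<S>. A S) = {w \<in> space M. {i \<in> I. X i w \<le> x} \<in> \<S>}"
      by (auto simp: A_def)
    thus ?thesis by (simp add: \<S>_def)
  qed
  show "{w \<in> space M. r \<le> card {i \<in> I. X i w \<le> x}} \<in> events"
    unfolding eq using fin\<S> A_ev by (intro sets.finite_UN) (auto simp: \<S>_def)
  have "prob (\<Union>S\<in>\<S>. A S) = (\<Sum>S\<in>\<S>. prob (A S))"
    using fin\<S> A_ev by (intro finite_measure_finite_Union) (auto simp: \<S>_def disjoint_family_on_def A_def)
  also have "\<dots> = (\<Sum>S\<in>\<S>. p ^ card S * (1 - p) ^ (card I - card S))"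
    by (intro sum.cong refl A_prob) (auto simp: \<S>_def)
  also have "\<dots> = (\<Sum>k = r..card I. \<Sum>S\<in>{S \<in> \<S>. card S = k}. p ^ card S * (1 - p) ^ (card I - card S))"
    using fin\<S> fin by (intro sum.group[symmetric]) (auto simp: \<S>_def card_mono)
  also have "\<dots> = binomial_tail (card I) r p"
    unfolding binomial_tail_def
  proof (intro sum.cong refl)
    fix k assume k: "k \<in> {r..card I}"
    have "{S \<in> \<S>. card S = k} = {S. S \<subseteq> I \<and> card S = k}" using k by (auto simp: \<S>_def)
    thus "(\<Sum>S\<in>{S \<in> \<S>. card S = k}. p ^ card S * (1 - p) ^ (card I - card S)) = real (card I choose k) * p ^ k * (1 - p) ^ (card I - k)"
      using fin by (simp add: n_subsets)
  qed
  finally show "prob {w \<in> space M. r \<le> card {i \<in> I. X i w \<le> x}} = binomial_tail (card I) r p"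
    unfolding eq .
qed

lemma prob_le_fd:
  assumes X: "distributed M lborel X (\<lambda>x. ennreal (fd c lb x))" and pos: "c > 0" "lb > 0" and x: "x \<ge> 0"
  shows "prob {w \<in> space M. X w \<le> x} = 1 - exp (- (c * lb * pi * x\<^sup>2))"
proof -
  have [measurable]: "fd c lb \<in> borel_measurable borel" unfolding fd_def by measurable
  have "emeasure M {w \<in> space M. X w \<le> x} = emeasure M (X -` {..x} \<inter> space M)"
    by (rule arg_cong[where f = "emeasure M"]) auto
  also have "\<dots> = (\<integral>\<^sup>+y. ennreal (fd c lb y) * indicator {..x} y \<partial>lborel)"
    by (rule distributed_emeasure[OF X]) simp
  also have "\<dots> = (\<integral>\<^sup>+y. ennreal (2 * c * lb * pi * y * exp (- c * lb * pi * y^2)) * indicator {0..x} y \<partial>lborel)"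
    by (intro nn_integral_cong) (auto simp: fd_def indicator_def)
  also have "\<dots> = ennreal (- exp (- (c * lb * pi * x\<^sup>2)) - (- exp (- (c * lb * pi * 0\<^sup>2))))"
    using x pos by (intro nn_integral_FTC_Icc) (auto intro!: derivative_eq_intros)
  finally have "emeasure M {w \<in> space M. X w \<le> x} = ennreal (1 - exp (- (c * lb * pi * x\<^sup>2)))" by simp
  thus ?thesis using pos by (simp add: measure_def)
qed

end

section \<open>The law of the squared r-th smallest distance\<close>

definition rth_exponential_density :: "nat \<Rightarrow> nat \<Rightarrow> real \<Rightarrow> real \<Rightarrow> real" where
  "rth_exponential_density n r mu y = (if y < 0 then 0 else real r * real (n choose r) *
      (1 - exp (- (mu * y))) ^ (r - 1) * exp (- (mu * y)) ^ (n - r) * (mu * exp (- (mu * y))))"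

lemma borel_measurable_rth_exponential_density [measurable]:
  "rth_exponential_density n r mu \<in> borel_measurable borel"
  unfolding rth_exponential_density_def[abs_def] by measurable

text \<open>The multiplier \<open>n - r + l + 1\<close> in the rate collects n - r from the survival
  factor, l from the binomial expansion and 1 from the derivative of the distribution
  function.\<close>

lemma rth_exponential_density_expand:
  assumes "y > 0"
  shows "rth_exponential_density n r mu y = real r * real (n choose r) *
     (\<Sum>l = 0..r-1. (-1) ^ l * real (r - 1 choose l) * (mu * exp (- (mu * real (n - r + l + 1) * y))))"
proof -
  define x where "x = exp (- (mu * y))"
  have pw: "exp (- (mu * real k * y)) = x ^ k" for k
    by (simp add: x_def flip: exp_of_nat_mult)
  have "(1 - x) ^ (r - 1) = (\<Sum>l = 0..r-1. (-1) ^ l * real (r - 1 choose l) * x ^ l)"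
    using binomial_ring[of "- x" 1 "r - 1"]
    by (simp add: power_minus[of x] atLeast0AtMost mult_ac)
  hence "rth_exponential_density n r mu y = real r * real (n choose r) * (\<Sum>l = 0..r-1. (-1) ^ l * real (r - 1 choose l) * x ^ l) * x ^ (n - r) * (mu * x)"
    using assms by (simp add: rth_exponential_density_def flip: x_def)
  also have "\<dots> = real r * real (n choose r) * (\<Sum>l = 0..r-1. (-1) ^ l * real (r - 1 choose l) * (mu * x ^ (n - r + l + 1)))"
    by (simp add: sum_distrib_left sum_distrib_right power_add mult_ac)
  finally show ?thesis unfolding pw .
qed

context prob_space
begin

context
  fixes D :: "nat \<Rightarrow> 'a \<Rightarrow> real" and c lb :: real and n r :: nat
  assumes pos: "c > 0" "lb > 0" and r: "1 \<le> r" "r \<le> n"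
    and indep: "indep_vars (\<lambda>_. borel) D {1..n}"
    and D: "\<And>i. i \<in> {1..n} \<Longrightarrow> distributed M lborel (D i) (\<lambda>x. ennreal (fd c lb x))"
begin

lemma prob_rth_smallest_le:
  assumes "x \<ge> 0"
  shows "{w \<in> space M. rth_smallest r D n w \<le> x} \<in> events"
    and "prob {w \<in> space M. rth_smallest r D n w \<le> x} = binomial_tail n r (1 - exp (- (c * lb * pi * x\<^sup>2)))"
proof -
  have p: "prob {w \<in> space M. D i w \<le> x} = 1 - exp (- (c * lb * pi * x\<^sup>2))" if "i \<in> {1..n}" for i
    using prob_le_fd[OF D[OF that] pos assms] .
  have I: "finite {1..n}" "{1..n} \<noteq> {}" using r by auto
  show "{w \<in> space M. rth_smallest r D n w \<le> x} \<in> events"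
    unfolding rth_smallest_le_iff[OF r] by (rule prob_card_le_eq_binomial_tail(1)[OF indep I p])
  show "prob {w \<in> space M. rth_smallest r D n w \<le> x} = binomial_tail n r (1 - exp (- (c * lb * pi * x\<^sup>2)))"
    using prob_card_le_eq_binomial_tail(2)[OF indep I p, of r]
    by (simp only: rth_smallest_le_iff[OF r] card_atLeastAtMost diff_Suc_1)
qed

text \<open>\<open>prob_rth_smallest_le\<close> handles only thresholds x >= 0, so all level sets
  are treated here directly in counting form.\<close>

lemma borel_measurable_rth_smallest: "rth_smallest r D n \<in> borel_measurable M"
proof (rule borel_measurableI_le)
  fix x
  have "D i \<in> borel_measurable M" if "i \<in> {1..n}" for i
    using indep that by (auto simp: indep_vars_def)
  hence [measurable]: "Measurable.pred M (\<lambda>w. D i w \<le> x)" if "i \<in> {1..n}" for i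
    using that by measurable
  show "{w \<in> space M. rth_smallest r D n w \<le> x} \<in> events"
    unfolding rth_smallest_le_iff[OF r] by measurable
qed

text \<open>The variables \<open>D i\<close> may be negative on a null set. Positivity almost
  everywhere justifies replacing d^2 <= a by d <= sqrt a, and d^alpha by (d^2)^(alpha/2).\<close>

lemma AE_rth_smallest_pos: "AE w in M. rth_smallest r D n w > 0"
proof -
  have "prob {w \<in> space M. rth_smallest r D n w \<le> 0} = 0"
    using prob_rth_smallest_le(2)[of 0] r by (simp add: binomial_tail_0)
  hence "AE w in M. \<not> rth_smallest r D n w \<le> 0"
    using prob_rth_smallest_le(1)[of 0] by (subst (asm) prob_eq_0) auto
  thus ?thesis by (simp add: not_le)
qed

text \<open>Distribution functions are compared. That of the square is \<open>binomial_tail\<close>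
  evaluated at the exponential distribution function; by the chain rule its derivative is the
  claimed density, and it vanishes at 0 because r >= 1.\<close>

lemma distributed_rth_smallest_sq:
  "distributed M lborel (\<lambda>w. (rth_smallest r D n w)\<^sup>2) (\<lambda>y. ennreal (rth_exponential_density n r (c * lb * pi) y))"
proof (rule distributedI_borel_atMost)
  let ?T = "\<lambda>y. binomial_tail n r (1 - exp (- (c * lb * pi * y)))"
  note [measurable] = borel_measurable_rth_smallest
  show "(\<lambda>w. (rth_smallest r D n w)\<^sup>2) \<in> borel_measurable M" by measurable
  show "rth_exponential_density n r (c * lb * pi) \<in> borel_measurable borel" by measurable
  have nn: "0 \<le> rth_exponential_density n r (c * lb * pi) y" for y using pos by (auto simp: rth_exponential_density_def)
  show "AE y in lborel. 0 \<le> rth_exponential_density n r (c * lb * pi) y" using nn by simp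
  fix a :: real
  show "(\<integral>\<^sup>+y. ennreal (rth_exponential_density n r (c * lb * pi) y * indicator {..a} y) \<partial>lborel) = ennreal (if a < 0 then 0 else ?T a)"
  proof (cases "a < 0")
    case False
    let ?f = "\<lambda>y. real r * real (n choose r) * (1 - exp (- (c * lb * pi * y))) ^ (r - 1) *
      exp (- (c * lb * pi * y)) ^ (n - r) * (c * lb * pi * exp (- (c * lb * pi * y)))"
    have "(\<integral>\<^sup>+y. ennreal (rth_exponential_density n r (c * lb * pi) y * indicator {..a} y) \<partial>lborel) = (\<integral>\<^sup>+y. ennreal (?f y) * indicator {0..a} y \<partial>lborel)"
      by (intro nn_integral_cong) (auto simp: rth_exponential_density_def indicator_def)
    also have "\<dots> = ennreal (?T a - ?T 0)"
    proof (rule nn_integral_FTC_Icc)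
      fix y assume y: "y \<in> {0..a}"
      have "((\<lambda>y. 1 - exp (- (c * lb * pi * y))) has_real_derivative c * lb * pi * exp (- (c * lb * pi * y))) (at y)"
        by (auto intro!: derivative_eq_intros)
      from DERIV_chain2[OF has_real_derivative_binomial_tail[OF r(2)] this]
      show "(?T has_real_derivative ?f y) (at y)" by simp
      show "0 \<le> ?f y" using nn[of y] y by (simp add: rth_exponential_density_def)
    qed (use False in auto)
    finally show ?thesis using False r by (simp add: binomial_tail_0)
  qed (auto simp: rth_exponential_density_def indicator_def intro!: nn_integral_zero')
  show "emeasure M {w \<in> space M. (rth_smallest r D n w)\<^sup>2 \<le> a} = ennreal (if a < 0 then 0 else ?T a)"
  proof (cases "a < 0")
    case True
    hence "{w \<in> space M. (rth_smallest r D n w)\<^sup>2 \<le> a} = {}"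
      by (auto simp: not_le intro: less_le_trans)
    thus ?thesis using True by (simp only: emeasure_empty) simp
  next
    case False
    have "emeasure M {w \<in> space M. (rth_smallest r D n w)\<^sup>2 \<le> a} = emeasure M {w \<in> space M. rth_smallest r D n w \<le> sqrt a}"
    proof (rule emeasure_eq_AE)
      show "AE w in M. w \<in> {w \<in> space M. (rth_smallest r D n w)\<^sup>2 \<le> a} \<longleftrightarrow> w \<in> {w \<in> space M. rth_smallest r D n w \<le> sqrt a}"
        using AE_rth_smallest_pos
        by eventually_elim (use False in \<open>auto simp: real_le_rsqrt real_sqrt_le_iff real_sqrt_unique intro: sqrt_ge_absD\<close>)
    qed measurable
    also have "\<dots> = ennreal (?T a)"
      using prob_rth_smallest_le(2)[of "sqrt a"] False by (simp add: emeasure_eq_measure)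
    finally show ?thesis using False by simp
  qed
qed

text \<open>In the variable y = d^2 the term with s^(2/alpha) is linear and merges with the
  exponential rates of the expanded density into one complex rate; only the noise term keeps the
  power y^(alpha/2).\<close>

lemma phi_rth_smallest:
  fixes alpha omega q :: real and s :: complex
  assumes q: "q \<ge> 0" and omega: "omega > 0" and s: "Re s > 0"
  defines "v \<equiv> s powr of_real (2 / alpha)"
  assumes v: "Re v > 0"
  shows "phi M (rth_smallest r D n) alpha lb omega q s = of_real (real r * real (n choose r)) *
     (\<Sum>l = 0..r-1. of_real ((-1) ^ l * real (r - 1 choose l)) * (of_real (c * lb * pi) *
        (LINT y:{0<..}|lborel. exp (- (of_real (pi * lb) * (of_real (real (n - r + l + 1) * c) + of_real omega * v) * of_real y)
           - of_real q * s * of_real (y powr (alpha / 2))))))"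
proof -
  define A where "A = (\<lambda>l. of_real (pi * lb) * (of_real (real (n - r + l + 1) * c) + of_real omega * v))"
  define G where "G = (\<lambda>y. exp (- (of_real q * s * of_real (y powr (alpha / 2))) - of_real (pi * lb * omega * y) * v))"
  define J where "J = (\<lambda>l y. exp (- (A l * of_real y) - of_real q * s * of_real (y powr (alpha / 2))))"
  have ReA: "Re (A l) > 0" for l
    using pos omega v unfolding A_def by (simp add: add_nonneg_pos)
  have [measurable]: "G \<in> borel_measurable borel" unfolding G_def by measurable
  \<comment> \<open>The noise factor has modulus at most 1 because q Re s >= 0, so the pure
    exponential with rate \<open>A l\<close> dominates.\<close>
  have J: "integrable lborel (\<lambda>y. indicator {0<..} y *\<^sub>R J l y)" for l
  proof (rule Bochner_Integration.integrable_bound)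
    show "integrable lborel (\<lambda>y. indicator {0<..} y *\<^sub>R (of_real y powr (1 - 1) * exp (- (A l * of_real y))))"
      using Gamma_integral_complex_rate(1)[of 1 "A l"] ReA by (simp add: set_integrable_def)
    show "(\<lambda>y. indicator {0<..} y *\<^sub>R J l y) \<in> borel_measurable lborel" unfolding J_def by measurable
    show "AE y in lborel. norm (indicator {0<..} y *\<^sub>R J l y) \<le> norm (indicator {0<..} y *\<^sub>R (of_real y powr (1 - 1) * exp (- (A l * of_real y))))"
      using q s by (auto simp: J_def indicator_def)
  qed
  note [measurable] = borel_measurable_rth_smallest
  have dist: "distr M lborel (\<lambda>w. (rth_smallest r D n w)\<^sup>2) = density lborel (\<lambda>y. ennreal (rth_exponential_density n r (c * lb * pi) y))"
    using distributed_rth_smallest_sq by (rule distributed_distr_eq_density)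
  have "phi M (rth_smallest r D n) alpha lb omega q s = (\<integral>w. G ((rth_smallest r D n w)\<^sup>2) \<partial>M)"
    unfolding phi_def v_def[symmetric]
  proof (intro integral_cong_AE)
    show "AE w in M. exp (- (complex_of_real q * s * complex_of_real (rth_smallest r D n w powr alpha))
         - complex_of_real (pi * lb * omega * (rth_smallest r D n w)\<^sup>2) * v) = G ((rth_smallest r D n w)\<^sup>2)"
      using AE_rth_smallest_pos
    proof eventually_elim
      case (elim w)
      hence "((rth_smallest r D n w)\<^sup>2) powr (alpha / 2) = rth_smallest r D n w powr alpha"
        by (simp add: powr_powr flip: powr_numeral)
      thus ?case by (simp add: G_def)
    qed
  qed measurable
  also have "\<dots> = (\<integral>y. G y \<partial>distr M lborel (\<lambda>w. (rth_smallest r D n w)\<^sup>2))"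
    by (rule integral_distr[symmetric]) auto
  also have "\<dots> = (\<integral>y. rth_exponential_density n r (c * lb * pi) y *\<^sub>R G y \<partial>lborel)"
    unfolding dist using pos by (intro integral_density) (auto simp: rth_exponential_density_def)
  also have "\<dots> = (\<integral>y. of_real (real r * real (n choose r)) * (\<Sum>l = 0..r-1. of_real ((-1) ^ l * real (r - 1 choose l)) * (of_real (c * lb * pi) *
        (indicator {0<..} y *\<^sub>R J l y))) \<partial>lborel)"
  proof (intro integral_cong_AE)
    show "(\<lambda>y. rth_exponential_density n r (c * lb * pi) y *\<^sub>R G y) \<in> borel_measurable lborel" by measurable
    show "(\<lambda>y. of_real (real r * real (n choose r)) * (\<Sum>l = 0..r-1. of_real ((-1) ^ l * real (r - 1 choose l)) * (of_real (c * lb * pi) *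
        (indicator {0<..} y *\<^sub>R J l y)))) \<in> borel_measurable lborel"
      unfolding J_def by measurable
    show "AE y in lborel. rth_exponential_density n r (c * lb * pi) y *\<^sub>R G y = of_real (real r * real (n choose r)) * (\<Sum>l = 0..r-1. of_real ((-1) ^ l * real (r - 1 choose l)) * (of_real (c * lb * pi) *
        (indicator {0<..} y *\<^sub>R J l y)))"
      \<comment> \<open>The two integrands can differ at y = 0, where the density need not vanish
        (it does not for r = 1) but the indicator does.\<close>
      using AE_lborel_singleton[of 0]
    proof eventually_elim
      case (elim y)
      show ?case
      proof (cases "y > 0")
        case True
        have "complex_of_real (exp (- (c * lb * pi * real (n - r + l + 1) * y))) * G y = J l y" for l
          by (simp add: G_def J_def A_def algebra_simps flip: exp_add exp_of_real)
        thus ?thesis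
          using True by (simp add: rth_exponential_density_expand scaleR_conv_of_real sum_distrib_right mult.assoc)
      qed (use elim in \<open>simp add: rth_exponential_density_def\<close>)
    qed
  qed
  also have "\<dots> = of_real (real r * real (n choose r)) * (\<Sum>l = 0..r-1. of_real ((-1) ^ l * real (r - 1 choose l)) * (of_real (c * lb * pi) *
        (LINT y:{0<..}|lborel. J l y)))"
  proof -
    have "(\<integral>y. (\<Sum>l = 0..r-1. of_real ((-1) ^ l * real (r - 1 choose l)) * (of_real (c * lb * pi) * (indicator {0<..} y *\<^sub>R J l y))) \<partial>lborel) =
      (\<Sum>l = 0..r-1. \<integral>y. of_real ((-1) ^ l * real (r - 1 choose l)) * (of_real (c * lb * pi) * (indicator {0<..} y *\<^sub>R J l y)) \<partial>lborel)"
      by (intro Bochner_Integration.integral_sum integrable_mult_right J)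
    thus ?thesis
      unfolding set_lebesgue_integral_def by (simp only: integral_mult_right_zero)
  qed
  finally show ?thesis unfolding J_def A_def by (simp add: mult.assoc)
qed

end

end

section \<open>Vanishing noise and assembly of the theorem\<close>

lemma (in prob_space) phi_tendsto_at_right_0:
  assumes d [measurable]: "d \<in> borel_measurable M" and lb: "lb > 0" and omega: "omega > 0"
    and s: "Re s > 0" "Re (s powr of_real (2 / alpha)) > 0"
  shows "((\<lambda>q. phi M d alpha lb omega q s) \<longlongrightarrow> phi M d alpha lb omega 0 s) (at_right 0)"
  \<comment> \<open>Putting q = 1/t turns the one-sided limit at 0 into a limit at infinity. The
    integrand is dominated by 1, since both terms of the exponent have nonpositive real part for q
    >= 0.\<close>
  unfolding filterlim_at_right_to_top phi_def
proof (rule integral_dominated_convergence_at_top)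
  let ?f = "\<lambda>q w. exp (- (complex_of_real q * s * complex_of_real (d w powr alpha))
      - complex_of_real (pi * lb * omega * (d w)\<^sup>2) * s powr complex_of_real (2 / alpha))"
  show "integrable M (\<lambda>_. 1 :: real)" by simp
  show "AE w in M. ((\<lambda>t. ?f (inverse t) w) \<longlongrightarrow> ?f 0 w) at_top"
    by (intro AE_I2 tendsto_intros tendsto_inverse_0_at_top filterlim_ident)
  show "\<forall>\<^sub>F t in at_top. AE w in M. norm (?f (inverse t) w) \<le> 1"
    using eventually_ge_at_top[of 0]
  proof eventually_elim
    case (elim t)
    have "norm (?f q w) \<le> 1" if "q \<ge> 0" for q w
    proof -
      have "0 \<le> q * Re s * d w powr alpha" "0 \<le> pi * lb * omega * (d w)\<^sup>2 * Re (s powr of_real (2 / alpha))"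
        using that s lb omega by simp_all
      thus ?thesis by simp
    qed
    thus ?case using elim by (intro AE_I2) (simp only: inverse_nonnegative_iff_nonnegative)
  qed
qed measurable

lemma Laplace_exponential:
  fixes A :: complex
  assumes "Re A > 0"
  shows "(LINT y:{0<..}|lborel. exp (- (A * of_real y))) = 1 / A"
proof -
  have "(LINT y:{0<..}|lborel. exp (- (A * of_real y))) = (LINT y:{0<..}|lborel. of_real y powr (1 - 1) * exp (- (A * of_real y)))"
    by (intro set_lebesgue_integral_cong) auto
  also have "\<dots> = 1 / A"
    using Gamma_integral_complex_rate(2)[of 1 A] assms by (auto simp: powr_minus powr_to_1 divide_inverse)
  finally show ?thesis .
qed

theorem theorem2:
  fixes M :: "'a measure" and D :: "nat \<Rightarrow> 'a \<Rightarrow> real"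
    and c alpha lb P sigma2 omega :: real and K r :: nat and s :: complex
  assumes "prob_space M"
    and "c = 5 / 4" and "alpha > 2" and "lb > 0" and "P > 0" and "sigma2 \<ge> 0" and "omega > 0"
    and "K \<ge> 1" and "1 \<le> r" and "r \<le> 2 * K"
    and "prob_space.indep_vars M (\<lambda>_. borel) D {1..2*K}"
    and "\<And>i. i \<in> {1..2*K} \<Longrightarrow> distributed M lborel (D i) (\<lambda>x. ennreal (fd c lb x))"
    and "Re s > 0"
  shows "(\<forall>gamma \<in> {0<..<2 / alpha}.
            phi M (rth_smallest r D (2*K)) alpha lb omega (sigma2 / P) s =
            complex_of_real (c * real r * real (2*K choose r)) *
            (\<Sum>l = 0..r-1.
               complex_of_real ((-1)^l * real (r - 1 choose l)) *
               fox_H alpha gamma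
                 (complex_of_real (sigma2 / P) * s *
                  (complex_of_real (pi * lb) *
                    (complex_of_real (real (2*K - r + l + 1) * c) + complex_of_real omega * s powr complex_of_real (2 / alpha)))
                  powr complex_of_real (- alpha / 2))
               / (complex_of_real (real (2*K - r + l + 1) * c) + complex_of_real omega * s powr complex_of_real (2 / alpha))))
         \<and> ((\<lambda>q. phi M (rth_smallest r D (2*K)) alpha lb omega q s) \<longlongrightarrow>
            complex_of_real (c * real r * real (2*K choose r)) *
            (\<Sum>l = 0..r-1.
               complex_of_real ((-1)^l * real (r - 1 choose l))
               / (complex_of_real (real (2*K - r + l + 1) * c) + complex_of_real omega * s powr complex_of_real (2 / alpha))))
           (at_right 0)"
proof -
  interpret prob_space M by fact
  define n where "n = 2 * K"
  define v where "v = s powr complex_of_real (2 / alpha)"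
  define m where "m = (\<lambda>l. real (n - r + l + 1) * c)"
  define A where "A = (\<lambda>l. complex_of_real (pi * lb) * (of_real (m l) + of_real omega * v))"
  have c: "c > 0" using assms by simp
  have m: "m l > 0" for l using c by (simp add: m_def)
  have A_eq: "A l = of_real (pi * lb * m l) + of_real (pi * lb * omega) * v" for l
    by (simp add: A_def algebra_simps)
  \<comment> \<open>The half-plane claim does not involve q, x and y; the three ones are
    placeholders.\<close>
  have v: "Re v > 0"
    using Ln_times_powr_eq(1)[of alpha s 1 1 1] assms by (simp add: v_def)
  have ReA: "Re (A l) > 0" for l
    unfolding A_eq using m[of l] v assms by (simp add: add_pos_pos)
  \<comment> \<open>The factor \<open>pi * lb\<close> of \<open>A l\<close> cancels against the
    exponential rate \<open>c * lb * pi\<close>, which leaves the prefactor c of the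
    theorem.\<close>
  have den: "complex_of_real (c * lb * pi) / A l = of_real c / (of_real (m l) + of_real omega * v)" for l
    using assms by (simp add: A_def)
  define J where "J = (\<lambda>q l. LINT y:{0<..}|lborel. exp (- (A l * of_real y) - of_real q * s * of_real (y powr (alpha / 2))))"
  have phi: "phi M (rth_smallest r D n) alpha lb omega q s = of_real (real r * real (n choose r)) *
      (\<Sum>l = 0..r-1. of_real ((-1) ^ l * real (r - 1 choose l)) * (of_real (c * lb * pi) * J q l))" if "q \<ge> 0" for q
    unfolding J_def A_def m_def v_def using assms c that v
    by (intro phi_rth_smallest) (auto simp: n_def v_def)
  \<comment> \<open>Stated for arbitrary \<open>H\<close> so that it serves both the Fox H values
    and, with \<open>H\<close> constantly 1, the limit formula.\<close>
  have step: "of_real (real r * real (n choose r)) *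
      (\<Sum>l = 0..r-1. of_real ((-1) ^ l * real (r - 1 choose l)) * (of_real (c * lb * pi) * (H l / A l))) =
      complex_of_real (c * real r * real (n choose r)) *
      (\<Sum>l = 0..r-1. of_real ((-1) ^ l * real (r - 1 choose l)) * H l / (of_real (m l) + of_real omega * v))" for H
  proof -
    have "of_real (c * lb * pi) * (H l / A l) = of_real c * (H l / (of_real (m l) + of_real omega * v))" for l
      using den[of l] by (metis times_divide_eq_left times_divide_eq_right mult.commute)
    thus ?thesis by (simp add: sum_distrib_left mult_ac)
  qed
  have J0: "J 0 l = 1 / A l" for l
    using Laplace_exponential[OF ReA] by (simp add: J_def)
  have first: "phi M (rth_smallest r D n) alpha lb omega q s =
      complex_of_real (c * real r * real (n choose r)) *
      (\<Sum>l = 0..r-1. of_real ((-1) ^ l * real (r - 1 choose l)) *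
         fox_H alpha g (of_real q * s * A l powr of_real (- alpha / 2)) / (of_real (m l) + of_real omega * v))"
    if q: "q \<ge> 0" and g: "g \<in> {0<..<2 / alpha}" for q g
  proof -
    have "J q l = fox_H alpha g (of_real q * s * A l powr of_real (- alpha / 2)) / A l" for l
    proof (cases "q = 0")
      \<comment> \<open>At q = 0 the argument of \<open>fox_H\<close> is 0, and its default value 1
        there agrees with \<open>J 0 l = 1 / A l\<close>.\<close>
      case True
      thus ?thesis using J0 by (simp add: fox_H_def)
    next
      case False
      have "Ln (of_real q * s * A l powr of_real (- alpha / 2)) = Ln (of_real q * s) - of_real (alpha / 2) * Ln (A l)"
        unfolding A_eq v_def using False q m[of l] assms by (intro Ln_times_powr_eq(2)) auto
      thus ?thesis
        unfolding J_def using False q g assms ReA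
        by (intro Laplace_stretched_exponential_eq_fox_H) auto
    qed
    thus ?thesis using phi[OF q] step by simp
  qed
  have "rth_smallest r D n \<in> borel_measurable M"
    unfolding n_def by (rule borel_measurable_rth_smallest[OF c]) (use assms in auto)
  from phi_tendsto_at_right_0[OF this, of lb omega s alpha] v assms
  have "((\<lambda>q. phi M (rth_smallest r D n) alpha lb omega q s) \<longlongrightarrow> phi M (rth_smallest r D n) alpha lb omega 0 s) (at_right 0)"
    by (simp add: v_def)
  also have "phi M (rth_smallest r D n) alpha lb omega 0 s = complex_of_real (c * real r * real (n choose r)) *
      (\<Sum>l = 0..r-1. of_real ((-1) ^ l * real (r - 1 choose l)) / (of_real (m l) + of_real omega * v))"
    using phi[of 0] step[of "\<lambda>_. 1"] by (simp only: J0 mult_1_right order.refl)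
  finally have second: "((\<lambda>q. phi M (rth_smallest r D n) alpha lb omega q s) \<longlongrightarrow>
      complex_of_real (c * real r * real (n choose r)) *
      (\<Sum>l = 0..r-1. of_real ((-1) ^ l * real (r - 1 choose l)) / (of_real (m l) + of_real omega * v))) (at_right 0)" .
  have "sigma2 / P \<ge> 0" using assms by simp
  from first[OF this] second show ?thesis
    unfolding A_def m_def v_def n_def by blast
qed

end
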